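(* Let $X$ be a smooth cubic fourfold. The nonzero eigenvalues of $c_1(X)\star$ satisfy $u_0+u_1+u_2=9(1+\zeta_3+\zeta_3^2)=0$ (where $\zeta_3=e^{2\pi i/3}$): the eigenvalue $0$ attached to $\mathcal{A}_X$ is their centroid. Consequently, on every ray $\theta$ avoiding the degenerate set $$\{\theta:\mathrm{Im}((u_i-u_j)e^{-i\theta})=0\text{ for some }i\neq j\}\cup\{\theta:\mathrm{Im}(u_ie^{-i\theta})=0\text{ for some }i\},$$ the phase slopes $-\mathrm{Im}(u_ie^{-i\theta})/\pi$ of the three exceptional sectors are nonzero, pairwise distinct, and sum to zero, so at least one is positive and one is negative; the slope $0$ of $\mathcal{A}_X$ is strictly interior to the exceptional slopes. In particular no ray realizes an ordering with $\mathcal{A}_X$ first or last: for every ray and every smooth cubic fourfold, the Kuznetsov component occupies an interior position of the induced ordering. The same holds for smooth cubic threefolds $Y$ (nonzero eigenvalues $u_\pm=\pm T$, with $\mathrm{Ku}(Y)$ always in the middle position).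
   Context: For a smooth cubic fourfold $X\subset\mathbb{P}^5$, $D^b(X)=\langle\mathcal{A}_X,\mathcal{O}_X,\mathcal{O}_X(1),\mathcal{O}_X(2)\rangle$; quantum multiplication $c_1(X)\star$ on small quantum cohomology (at quantum parameter $1$) has three simple nonzero eigenvalues $u_0,u_1,u_2=9,\,9e^{\pm2\pi i/3}$, attached to the exceptional sectors, and the eigenvalue $0$ of multiplicity $24$, attached to $\mathcal{A}_X$. For a smooth cubic threefold $Y\subset\mathbb{P}^4$, $D^b(Y)=\langle\mathrm{Ku}(Y),\mathcal{O},\mathcal{O}(1)\rangle$; $c_1(Y)\star$ has two simple nonzero eigenvalues $\pm T$ with $T>0$, attached to the two exceptional sectors, and the eigenvalue $0$ attached to $\mathrm{Ku}(Y)$. Along a ray $z=e^{i\theta}/t$, $t\to+\infty$, a sector with eigenvalue $u$ has phase slope $-\mathrm{Im}(ue^{-i\theta})/\pi$, and the induced ordering of sectors is the ordering by phase slope (for threefolds, non-degenerate rays are those with $\mathrm{Im}(Te^{-i\theta})\ne0$). *)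

theory Defs
  imports
    "HOL-Analysis.Analysis"
    "HOL-Homology.Homology"
    "HOL-Library.Function_Algebras"
begin

section \<open>Smooth cubic hypersurfaces\<close>

definition cubic_form :: "(complex^'n \<Rightarrow> complex) \<Rightarrow> bool" where
  "cubic_form F \<longleftrightarrow>
     (\<exists>c. \<forall>x. F x = (\<Sum>i\<in>UNIV. \<Sum>j\<in>UNIV. \<Sum>k\<in>UNIV. c i j k * x $ i * x $ j * x $ k))"

text \<open>A hypersurface in projective space of dimension \<open>CARD('n) - 1\<close> is given by its equation.
  The Jacobian criterion below also excludes \<open>F = 0\<close>.\<close>

definition smooth_cubic :: "(complex^'n \<Rightarrow> complex) \<Rightarrow> bool" where
  "smooth_cubic F \<longleftrightarrow> cubic_form F \<and>
     (\<forall>x. x \<noteq> 0 \<and> F x = 0 \<longrightarrow> (\<exists>i. deriv (\<lambda>t. F (x + axis i t)) 0 \<noteq> 0))"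

text \<open>Projective space is realised inside the Hermitian matrices, the point \<open>[x]\<close> being the
  orthogonal projection onto the line spanned by \<open>x\<close>. This gives it its usual topology.\<close>

definition proj_point :: "complex^'n \<Rightarrow> complex^'n^'n" where
  "proj_point x = (\<chi> i j. x $ i * cnj (x $ j) / of_real ((norm x)\<^sup>2))"

definition hypersurface :: "(complex^'n \<Rightarrow> complex) \<Rightarrow> (complex^'n^'n) set" where
  "hypersurface F = proj_point ` {x. x \<noteq> 0 \<and> F x = 0}"


section \<open>Complex cohomology\<close>

text \<open>By universal coefficients, \<open>H\<^sup>p(X; \<complex>) = Hom(H\<^sub>p(X; \<int>), \<complex>)\<close>. Homomorphisms are extended
  by zero outside the carrier, so that the vector space operations are the pointwise ones. A class
  of mixed degree is the family of its homogeneous components; since a hypersurface is a compact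
  manifold, only finitely many of these can be nonzero.\<close>

type_synonym 'n cohomology_class = "int \<Rightarrow> (complex^'n^'n) chain set \<Rightarrow> complex"

abbreviation homology_of :: "(complex^'n \<Rightarrow> complex) \<Rightarrow> int \<Rightarrow> (complex^'n^'n) chain set monoid" where
  "homology_of F p \<equiv> homology_group p (top_of_set (hypersurface F))"

definition cohomology :: "(complex^'n \<Rightarrow> complex) \<Rightarrow> 'n cohomology_class set" where
  "cohomology F = {\<alpha>. \<forall>p.
     (\<forall>a \<in> carrier (homology_of F p). \<forall>b \<in> carrier (homology_of F p).
        \<alpha> p (a \<otimes>\<^bsub>homology_of F p\<^esub> b) = \<alpha> p a + \<alpha> p b) \<and>
     (\<forall>a. a \<notin> carrier (homology_of F p) \<longrightarrow> \<alpha> p a = 0)}"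

definition scale_class :: "complex \<Rightarrow> 'n cohomology_class \<Rightarrow> 'n cohomology_class" where
  "scale_class c \<alpha> = (\<lambda>p a. c * \<alpha> p a)"

lemma vector_space_scale_class: "vector_space scale_class"
  by unfold_locales (auto simp: scale_class_def fun_eq_iff algebra_simps)

definition has_degree :: "int \<Rightarrow> 'n cohomology_class \<Rightarrow> bool" where
  "has_degree p \<alpha> \<longleftrightarrow> (\<forall>q. q \<noteq> p \<longrightarrow> \<alpha> q = 0)"

definition unit_class :: "(complex^'n \<Rightarrow> complex) \<Rightarrow> 'n cohomology_class" where
  "unit_class F = (THE \<alpha>. \<alpha> \<in> cohomology F \<and> has_degree 0 \<alpha> \<and>
     (\<forall>x \<in> hypersurface F.
        \<alpha> 0 (homologous_rel_set 0 (top_of_set (hypersurface F)) {}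
               (frag_of (restrict (\<lambda>_. x) (standard_simplex 0)))) = 1))"

text \<open>For linearly independent \<open>p\<close>, \<open>q\<close>, the simplex below maps the interior of the 2-simplex
  homeomorphically, and preserving orientation, onto the line through \<open>[p]\<close> and \<open>[q]\<close> minus \<open>[p]\<close>,
  and maps the boundary to \<open>[p]\<close>. Indeed \<open>z = t\<^sub>0 + t\<^sub>1 \<zeta>\<^sub>3 + t\<^sub>2 \<zeta>\<^sub>3\<^sup>2\<close> identifies the simplex
  with a counterclockwise triangle around 0, the image point has affine coordinate
  \<open>z / (t\<^sub>0 t\<^sub>1 t\<^sub>2)\<close> on the line, and the denominator vanishes exactly
  on the boundary. Subtracting a constant simplex gives a cycle, which represents the fundamental
  class of the line with its complex orientation.\<close>

definition line_cycle :: "complex^'n \<Rightarrow> complex^'n \<Rightarrow> (complex^'n^'n) chain" where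
  "line_cycle p q =
     frag_of (\<lambda>t\<in>standard_simplex 2. proj_point
       ((of_real (t 0) + of_real (t 1) * cis (2 * pi / 3) + of_real (t 2) * cis (4 * pi / 3)) *s p
          + of_real (t 0 * t 1 * t 2) *s q))
     - frag_of (\<lambda>t\<in>standard_simplex 2. proj_point p)"

text \<open>The hyperplane class is the class in \<open>H\<^sup>2\<close> taking the value 1 on every line of the
  hypersurface. It is unique in dimension at least 3, where the second homology is freely generated
  by the class of a line.\<close>

definition hyperplane_class :: "(complex^'n \<Rightarrow> complex) \<Rightarrow> 'n cohomology_class" where
  "hyperplane_class F = (THE \<alpha>. \<alpha> \<in> cohomology F \<and> has_degree 2 \<alpha> \<and>
     (\<forall>p q. (\<forall>a b. a *s p + b *s q = 0 \<longrightarrow> a = 0 \<and> b = 0) \<and> (\<forall>a b. F (a *s p + b *s q) = 0)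
        \<longrightarrow> \<alpha> 2 (homologous_rel_set 2 (top_of_set (hypersurface F)) {} (line_cycle p q)) = 1))"

text \<open>Adjunction: a cubic in projective space of dimension \<open>N\<close> has \<open>c\<^sub>1 = (N + 1 - 3) h\<close>.\<close>

definition first_chern_class :: "(complex^'n \<Rightarrow> complex) \<Rightarrow> 'n cohomology_class" where
  "first_chern_class F = scale_class (of_int (int CARD('n) - 3)) (hyperplane_class F)"


section \<open>Small quantum multiplication\<close>

text \<open>\<open>GW d \<alpha> \<beta> \<gamma>\<close> stands for the genus 0 three-point invariant \<open>\<langle>\<alpha>, \<beta>, \<gamma>\<rangle>\<close> in curve class
  \<open>d\<close> times the class of a line. The moduli spaces of stable maps and their virtual classes
  are not constructed: the invariants are a parameter, constrained by the three-point
  Kontsevich-Manin axioms.\<close>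

type_synonym 'n three_point_invariants =
  "nat \<Rightarrow> 'n cohomology_class \<Rightarrow> 'n cohomology_class \<Rightarrow> 'n cohomology_class \<Rightarrow> complex"

definition linear_functional ::
  "(complex^'n \<Rightarrow> complex) \<Rightarrow> ('n cohomology_class \<Rightarrow> complex) \<Rightarrow> bool" where
  "linear_functional F f \<longleftrightarrow>
     (\<forall>\<alpha> \<in> cohomology F. \<forall>\<beta> \<in> cohomology F. f (\<alpha> + \<beta>) = f \<alpha> + f \<beta>) \<and>
     (\<forall>c. \<forall>\<alpha> \<in> cohomology F. f (scale_class c \<alpha>) = c * f \<alpha>)"

text \<open>The Poincare pairing is the invariant \<open>\<langle>1, \<alpha>, \<beta>\<rangle>\<close> in curve class 0.\<close>

definition poincare_pairing ::
  "(complex^'n \<Rightarrow> complex) \<Rightarrow> 'n three_point_invariants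
     \<Rightarrow> 'n cohomology_class \<Rightarrow> 'n cohomology_class \<Rightarrow> complex" where
  "poincare_pairing F GW \<alpha> \<beta> = GW 0 (unit_class F) \<alpha> \<beta>"

text \<open>The conjuncts are: trilinearity; the dimension axiom, with \<open>CARD('n) - 2\<close> the complex dimension
  and \<open>CARD('n) - 3\<close> the degree of \<open>c\<^sub>1\<close> on a line; graded symmetry; the fundamental class axiom;
  and Poincare duality.\<close>

definition gromov_witten_axioms ::
  "(complex^'n \<Rightarrow> complex) \<Rightarrow> 'n three_point_invariants \<Rightarrow> bool" where
  "gromov_witten_axioms F GW \<longleftrightarrow>
     (\<forall>d. \<forall>\<alpha> \<in> cohomology F. \<forall>\<beta> \<in> cohomology F.
        linear_functional F (\<lambda>\<gamma>. GW d \<gamma> \<alpha> \<beta>) \<and>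
        linear_functional F (\<lambda>\<gamma>. GW d \<alpha> \<gamma> \<beta>) \<and>
        linear_functional F (\<lambda>\<gamma>. GW d \<alpha> \<beta> \<gamma>)) \<and>
     (\<forall>d. \<forall>\<alpha> \<in> cohomology F. \<forall>\<beta> \<in> cohomology F. \<forall>\<gamma> \<in> cohomology F. \<forall>p q r.
        has_degree p \<alpha> \<and> has_degree q \<beta> \<and> has_degree r \<gamma> \<longrightarrow>
          (GW d \<alpha> \<beta> \<gamma> \<noteq> 0 \<longrightarrow>
             p + q + r = 2 * (int CARD('n) - 2) + 2 * (int CARD('n) - 3) * int d) \<and>
          GW d \<beta> \<alpha> \<gamma> = (if odd p \<and> odd q then - 1 else 1) * GW d \<alpha> \<beta> \<gamma> \<and>
          GW d \<alpha> \<gamma> \<beta> = (if odd q \<and> odd r then - 1 else 1) * GW d \<alpha> \<beta> \<gamma>) \<and>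
     (\<forall>d > 0. \<forall>\<alpha> \<in> cohomology F. \<forall>\<beta> \<in> cohomology F. GW d (unit_class F) \<alpha> \<beta> = 0) \<and>
     (\<forall>\<alpha> \<in> cohomology F. (\<forall>\<beta> \<in> cohomology F. poincare_pairing F GW \<alpha> \<beta> = 0) \<longrightarrow> \<alpha> = 0)"

text \<open>Quantum parameter 1; the sum over \<open>d\<close> is finite by the dimension axiom.\<close>

definition quantum_product ::
  "(complex^'n \<Rightarrow> complex) \<Rightarrow> 'n three_point_invariants
     \<Rightarrow> 'n cohomology_class \<Rightarrow> 'n cohomology_class \<Rightarrow> 'n cohomology_class" where
  "quantum_product F GW \<alpha> \<beta> = (THE \<gamma>. \<gamma> \<in> cohomology F \<and>
     (\<forall>\<delta> \<in> cohomology F.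
        poincare_pairing F GW \<gamma> \<delta> = (\<Sum>d | GW d \<alpha> \<beta> \<delta> \<noteq> 0. GW d \<alpha> \<beta> \<delta>)))"

definition c1_star ::
  "(complex^'n \<Rightarrow> complex) \<Rightarrow> 'n three_point_invariants
     \<Rightarrow> 'n cohomology_class \<Rightarrow> 'n cohomology_class" where
  "c1_star F GW = quantum_product F GW (first_chern_class F)"

definition c1_eigenvalues ::
  "(complex^'n \<Rightarrow> complex) \<Rightarrow> 'n three_point_invariants \<Rightarrow> complex set" where
  "c1_eigenvalues F GW =
     {u. \<exists>\<alpha> \<in> cohomology F. \<alpha> \<noteq> 0 \<and> c1_star F GW \<alpha> = scale_class u \<alpha>}"

text \<open>Algebraic multiplicity: the dimension of the generalised eigenspace.\<close>

definition c1_multiplicity ::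
  "(complex^'n \<Rightarrow> complex) \<Rightarrow> 'n three_point_invariants \<Rightarrow> complex \<Rightarrow> nat" where
  "c1_multiplicity F GW u = vector_space.dim scale_class
     {\<alpha> \<in> cohomology F. \<exists>k. ((\<lambda>\<beta>. c1_star F GW \<beta> - scale_class u \<beta>) ^^ k) \<alpha> = 0}"


section \<open>Sectors, phase slopes and induced orderings\<close>

text \<open>The components of \<open>D\<^sup>b = \<langle>Ku, O, O(1), \<dots>, O(r - 1)\<rangle>\<close>.\<close>

datatype sector = Kuznetsov | Line_Bundle nat

definition sectors :: "nat \<Rightarrow> sector set" where
  "sectors r = insert Kuznetsov (Line_Bundle ` {..<r})"

text \<open>Which simple eigenvalue belongs to which exceptional sector is left open.\<close>

definition attached_eigenvalues ::
  "(complex^'n \<Rightarrow> complex) \<Rightarrow> 'n three_point_invariants \<Rightarrow> nat \<Rightarrow> (sector \<Rightarrow> complex) \<Rightarrow> bool" where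
  "attached_eigenvalues F GW r \<mu> \<longleftrightarrow>
     \<mu> Kuznetsov = 0 \<and> bij_betw (\<lambda>i. \<mu> (Line_Bundle i)) {..<r} (c1_eigenvalues F GW - {0})"

definition phase_slope :: "real \<Rightarrow> complex \<Rightarrow> real" where
  "phase_slope \<theta> u = - Im (u * exp (- \<i> * of_real \<theta>)) / pi"

definition degenerate_rays :: "nat \<Rightarrow> (nat \<Rightarrow> complex) \<Rightarrow> real set" where
  "degenerate_rays r u =
     {\<theta>. \<exists>i<r. \<exists>j<r. i \<noteq> j \<and> Im ((u i - u j) * exp (- \<i> * of_real \<theta>)) = 0} \<union>
     {\<theta>. \<exists>i<r. Im (u i * exp (- \<i> * of_real \<theta>)) = 0}"

text \<open>On a degenerate ray sectors may have equal slopes; every way of breaking the ties then counts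
  as an induced ordering.\<close>

definition induced_ordering :: "nat \<Rightarrow> (sector \<Rightarrow> complex) \<Rightarrow> real \<Rightarrow> sector list \<Rightarrow> bool" where
  "induced_ordering r \<mu> \<theta> ss \<longleftrightarrow> distinct ss \<and> set ss = sectors r \<and>
     sorted_wrt (\<lambda>s s'. phase_slope \<theta> (\<mu> s) \<le> phase_slope \<theta> (\<mu> s')) ss"

lemma induced_ordering_exists: "\<exists>ss. induced_ordering r \<mu> \<theta> ss"
proof -
  have "finite (sectors r)" by (simp add: sectors_def)
  then obtain ss where ss: "set ss = sectors r" "distinct ss"
    using finite_distinct_list by blast
  have "sorted (map (\<lambda>s. phase_slope \<theta> (\<mu> s)) (sort_key (\<lambda>s. phase_slope \<theta> (\<mu> s)) ss))"
    by (rule sorted_sort_key)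
  with ss have "induced_ordering r \<mu> \<theta> (sort_key (\<lambda>s. phase_slope \<theta> (\<mu> s)) ss)"
    by (simp add: induced_ordering_def sorted_wrt_map)
  then show ?thesis ..
qed

end

theory Submission
  imports Defs
begin

text \<open>Phase slope is real-linear, so the slopes of the exceptional sectors sum to zero with the
  nonzero eigenvalues, and a single nonvanishing slope forces slopes of both signs. For fourfolds
  such a slope exists even on a degenerate ray: eigenvalues of slope 0 lie on one real line, which
  does not contain both \<open>9\<close> and \<open>9 \<zeta>\<^sub>3\<close>.\<close>

text \<open>Otherwise all values have one weak sign, and a vanishing sum then makes each of them
  vanish, against \<open>f a \<noteq> 0\<close>.\<close>

lemma exists_pos_neg_if_sum_zero:
  fixes f :: "'a \<Rightarrow> real"
  assumes "finite A" and "sum f A = 0" and "a \<in> A" and "f a \<noteq> 0"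
  shows "\<exists>x\<in>A. f x > 0" and "\<exists>x\<in>A. f x < 0"
proof -
  show "\<exists>x\<in>A. f x > 0"
  proof (rule ccontr)
    assume "\<not> (\<exists>x\<in>A. f x > 0)"
    then have "sum (\<lambda>x. - f x) A = 0 \<longleftrightarrow> (\<forall>x\<in>A. - f x = 0)"
      using assms(1) by (intro sum_nonneg_eq_0_iff) (auto simp: not_less)
    then show False using assms by (auto simp: sum_negf)
  qed
  show "\<exists>x\<in>A. f x < 0"
  proof (rule ccontr)
    assume "\<not> (\<exists>x\<in>A. f x < 0)"
    then have "sum f A = 0 \<longleftrightarrow> (\<forall>x\<in>A. f x = 0)"
      using assms(1) by (intro sum_nonneg_eq_0_iff) (auto simp: not_less)
    then show False using assms by auto
  qed
qed

section \<open>Real-linearity of the phase slope\<close>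

lemma phase_slope_0 [simp]: "phase_slope \<theta> 0 = 0"
  by (simp add: phase_slope_def)

lemma phase_slope_minus: "phase_slope \<theta> (- u) = - phase_slope \<theta> u"
  by (simp add: phase_slope_def del: times_complex.sel)

lemma phase_slope_eq_0_iff: "phase_slope \<theta> u = 0 \<longleftrightarrow> Im (u * exp (- \<i> * of_real \<theta>)) = 0"
  by (simp add: phase_slope_def del: times_complex.sel)

lemma phase_slope_eq_iff:
  "phase_slope \<theta> u = phase_slope \<theta> v \<longleftrightarrow> Im ((u - v) * exp (- \<i> * of_real \<theta>)) = 0"
  unfolding phase_slope_def left_diff_distrib minus_complex.sel
  by (simp del: times_complex.sel)

lemma phase_slope_sum: "phase_slope \<theta> (sum u A) = (\<Sum>i\<in>A. phase_slope \<theta> (u i))"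
  by (simp add: phase_slope_def sum_distrib_right Im_sum sum_divide_distrib sum_negf
      del: times_complex.sel)

text \<open>Rotation by the angle \<open>- \<theta>\<close> makes \<open>u\<close> and
  \<open>v\<close> both real and leaves \<open>u * cnj v\<close> unchanged. Contrapositively, two
  numbers on different real lines through 0 cannot both have slope 0, whatever the ray.\<close>

lemma Im_mult_cnj_eq_0_if_phase_slopes_0:
  assumes "phase_slope \<theta> u = 0" and "phase_slope \<theta> v = 0"
  shows "Im (u * cnj v) = 0"
proof -
  define w where "w = exp (- \<i> * complex_of_real \<theta>)"
  have "norm w = 1" by (simp add: w_def norm_exp_eq_Re)
  then have "w * cnj w = 1" by (simp flip: complex_norm_square)
  then have "u * cnj v = (u * w) * cnj (v * w)"
    by (metis (no_types, lifting) complex_cnj_mult mult.assoc mult.commute mult.right_neutral)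
  moreover have "Im (u * w) = 0" "Im (v * w) = 0"
    using assms unfolding phase_slope_eq_0_iff w_def by auto
  moreover have "Im (a * cnj b) = 0" if "Im a = 0" "Im b = 0" for a b
    using that by simp
  ultimately show ?thesis by metis
qed

section \<open>Position of the Kuznetsov component in an induced ordering\<close>

lemma length_induced_ordering:
  assumes "induced_ordering r \<mu> \<theta> ss"
  shows "length ss = Suc r"
proof -
  have "length ss = card (sectors r)"
    using assms by (metis distinct_card induced_ordering_def)
  also have "\<dots> = Suc (card (Line_Bundle ` {..<r}))"
    unfolding sectors_def by (rule card_insert_disjoint) auto
  also have "\<dots> = Suc r" by (simp add: card_image inj_on_def)
  finally show ?thesis .
qed

text \<open>Strict inequalities make the argument independent of how ties are broken: a sector of
  strictly smaller slope must stand before \<open>Kuznetsov\<close>, one of strictly larger slope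
  after it.\<close>

lemma Kuznetsov_interior:
  assumes ord: "induced_ordering r \<mu> \<theta> ss"
    and neg: "i < r" "phase_slope \<theta> (\<mu> (Line_Bundle i)) < phase_slope \<theta> (\<mu> Kuznetsov)"
    and pos: "j < r" "phase_slope \<theta> (\<mu> Kuznetsov) < phase_slope \<theta> (\<mu> (Line_Bundle j))"
  shows "hd ss \<noteq> Kuznetsov \<and> last ss \<noteq> Kuznetsov \<and>
    (\<exists>k. 0 < k \<and> k < length ss - 1 \<and> ss ! k = Kuznetsov)"
proof -
  have dist: "distinct ss" and set: "set ss = sectors r"
    and sorted: "\<And>m n. m < n \<Longrightarrow> n < length ss \<Longrightarrow>
      phase_slope \<theta> (\<mu> (ss ! m)) \<le> phase_slope \<theta> (\<mu> (ss ! n))"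
    using ord by (auto simp: induced_ordering_def sorted_wrt_iff_nth_less)
  have "Kuznetsov \<in> set ss" "Line_Bundle i \<in> set ss" "Line_Bundle j \<in> set ss"
    using neg pos by (auto simp: set sectors_def)
  then obtain k a b where k: "k < length ss" "ss ! k = Kuznetsov"
    and a: "a < length ss" "ss ! a = Line_Bundle i"
    and b: "b < length ss" "ss ! b = Line_Bundle j"
    by (auto simp: in_set_conv_nth)
  \<comment> \<open>Sortedness excludes \<open>k < a\<close>, and \<open>a = k\<close> would
    identify a line bundle with \<open>Kuznetsov\<close>.\<close>
  have "a < k"
    using sorted[of k a] neg k a by (cases a k rule: linorder_cases) auto
  moreover have "k < b"
    using sorted[of b k] pos k b by (cases k b rule: linorder_cases) auto
  ultimately have k': "0 < k" "k < length ss - 1" using b by auto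
  have "ss \<noteq> []" using k by auto
  then have "hd ss = ss ! 0" "last ss = ss ! (length ss - 1)"
    by (simp_all add: hd_conv_nth last_conv_nth)
  \<comment> \<open>By distinctness \<open>Kuznetsov\<close> occurs only at \<open>k\<close>, which
    is neither end.\<close>
  moreover have "ss ! 0 \<noteq> ss ! k" "ss ! (length ss - 1) \<noteq> ss ! k"
    using k(1) k' \<open>ss \<noteq> []\<close> by (simp_all add: nth_eq_iff_index_eq[OF dist])
  ultimately show ?thesis using k k' by auto
qed

section \<open>Eigenvalues attached to the exceptional sectors\<close>

lemma attached_eigenvalues_sum:
  assumes "attached_eigenvalues F GW r \<mu>"
  shows "(\<Sum>i<r. \<mu> (Line_Bundle i)) = (\<Sum>u \<in> c1_eigenvalues F GW - {0}. u)"
  using assms unfolding attached_eigenvalues_def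
  by (blast intro: sum.reindex_bij_betw[where g = "\<lambda>u. u"])

lemma attached_eigenvalues_Kuznetsov:
  "attached_eigenvalues F GW r \<mu> \<Longrightarrow> \<mu> Kuznetsov = 0"
  by (simp add: attached_eigenvalues_def)

lemma attached_eigenvalues_image:
  assumes "attached_eigenvalues F GW r \<mu>"
  shows "(\<lambda>i. \<mu> (Line_Bundle i)) ` {..<r} = c1_eigenvalues F GW - {0}"
  using assms by (simp add: attached_eigenvalues_def bij_betw_def)

text \<open>Linearity turns \<open>sum0\<close> into a vanishing sum of slopes. The ray enters only
  through one eigenvalue of nonzero slope, so degenerate rays with such an eigenvalue are
  covered.\<close>

lemma slopes_of_both_signs:
  assumes att: "attached_eigenvalues F GW r \<mu>"
    and sum0: "(\<Sum>u \<in> c1_eigenvalues F GW - {0}. u) = 0"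
    and u: "u \<in> c1_eigenvalues F GW" "phase_slope \<theta> u \<noteq> 0"
  shows "(\<Sum>i<r. phase_slope \<theta> (\<mu> (Line_Bundle i))) = 0"
    and "\<exists>i<r. phase_slope \<theta> (\<mu> (Line_Bundle i)) > 0"
    and "\<exists>i<r. phase_slope \<theta> (\<mu> (Line_Bundle i)) < 0"
proof -
  let ?s = "\<lambda>i. phase_slope \<theta> (\<mu> (Line_Bundle i))"
  show sum: "(\<Sum>i<r. ?s i) = 0"
    by (simp add: attached_eigenvalues_sum[OF att] sum0 flip: phase_slope_sum)
  \<comment> \<open>The eigenvalue 0 has slope 0, so \<open>u\<close> is attached to some line
    bundle.\<close>
  have "u \<noteq> 0" using u(2) by auto
  then obtain i where "i \<in> {..<r}" "?s i \<noteq> 0"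
    using u attached_eigenvalues_image[OF att] by (metis DiffI imageE singletonD)
  from exists_pos_neg_if_sum_zero[OF _ sum this]
  show "\<exists>i<r. ?s i > 0" and "\<exists>i<r. ?s i < 0" by auto
qed

lemma Kuznetsov_interior_if_both_signs:
  assumes "induced_ordering r \<mu> \<theta> ss" and "\<mu> Kuznetsov = 0"
    and "\<exists>i<r. phase_slope \<theta> (\<mu> (Line_Bundle i)) > 0"
    and "\<exists>i<r. phase_slope \<theta> (\<mu> (Line_Bundle i)) < 0"
  shows "hd ss \<noteq> Kuznetsov \<and> last ss \<noteq> Kuznetsov \<and>
    (\<exists>k. 0 < k \<and> k < length ss - 1 \<and> ss ! k = Kuznetsov)"
proof -
  obtain i j where "i < r" "phase_slope \<theta> (\<mu> (Line_Bundle i)) < phase_slope \<theta> (\<mu> Kuznetsov)"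
    "j < r" "phase_slope \<theta> (\<mu> Kuznetsov) < phase_slope \<theta> (\<mu> (Line_Bundle j))"
    using assms(2-4) by auto
  then show ?thesis by (rule Kuznetsov_interior[OF assms(1)])
qed

section \<open>Cartesian form of the primitive third roots of unity\<close>

lemma exp_third_root: "exp (2 * of_real pi * \<i> / 3) = Complex (- 1 / 2) (sqrt 3 / 2)"
proof -
  have "exp (2 * of_real pi * \<i> / 3) = cis (2 * pi / 3)"
    by (simp add: cis_conv_exp mult_ac)
  then show ?thesis by (simp add: complex_eq_iff cos_120 sin_120)
qed

lemma exp_minus_third_root:
  "exp (- (2 * of_real pi * \<i> / 3)) = Complex (- 1 / 2) (- sqrt 3 / 2)"
proof -
  have "exp (- (2 * of_real pi * \<i> / 3)) = cnj (exp (2 * of_real pi * \<i> / 3))"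
    by (simp add: exp_cnj)
  then show ?thesis by (simp add: exp_third_root complex_eq_iff)
qed

theorem lemma6p5:
  fixes \<zeta> :: complex
  defines "\<zeta> \<equiv> exp (2 * of_real pi * \<i> / 3)"
  shows
    "(\<forall>(F :: complex^6 \<Rightarrow> complex) GW \<mu>.
        smooth_cubic F \<and> gromov_witten_axioms F GW \<and>
        c1_eigenvalues F GW =
          {0, 9, 9 * exp (2 * of_real pi * \<i> / 3), 9 * exp (- (2 * of_real pi * \<i> / 3))} \<and>
        c1_multiplicity F GW 0 = 24 \<and>
        (\<forall>u \<in> c1_eigenvalues F GW - {0}. c1_multiplicity F GW u = 1) \<and>
        attached_eigenvalues F GW 3 \<mu>
        \<longrightarrow>
        (\<Sum>u \<in> c1_eigenvalues F GW - {0}. u) = 9 * (1 + \<zeta> + \<zeta>\<^sup>2) \<and>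
        9 * (1 + \<zeta> + \<zeta>\<^sup>2) = 0 \<and>
        \<mu> Kuznetsov = (\<Sum>i<3. \<mu> (Line_Bundle i)) / 3 \<and>
        (\<forall>\<theta>. \<theta> \<notin> degenerate_rays 3 (\<lambda>i. \<mu> (Line_Bundle i)) \<longrightarrow>
           (\<forall>i<3. phase_slope \<theta> (\<mu> (Line_Bundle i)) \<noteq> 0) \<and>
           inj_on (\<lambda>i. phase_slope \<theta> (\<mu> (Line_Bundle i))) {..<3} \<and>
           (\<Sum>i<3. phase_slope \<theta> (\<mu> (Line_Bundle i))) = 0 \<and>
           (\<exists>i<3. phase_slope \<theta> (\<mu> (Line_Bundle i)) > 0) \<and>
           (\<exists>i<3. phase_slope \<theta> (\<mu> (Line_Bundle i)) < 0) \<and>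
           phase_slope \<theta> (\<mu> Kuznetsov) = 0 \<and>
           (\<exists>i<3. \<exists>j<3.
              phase_slope \<theta> (\<mu> (Line_Bundle i)) < phase_slope \<theta> (\<mu> Kuznetsov) \<and>
              phase_slope \<theta> (\<mu> Kuznetsov) < phase_slope \<theta> (\<mu> (Line_Bundle j)))) \<and>
        (\<forall>\<theta> ss. induced_ordering 3 \<mu> \<theta> ss \<longrightarrow>
           hd ss \<noteq> Kuznetsov \<and> last ss \<noteq> Kuznetsov \<and>
           (\<exists>k. 0 < k \<and> k < length ss - 1 \<and> ss ! k = Kuznetsov)))
     \<and>
     (\<forall>(G :: complex^5 \<Rightarrow> complex) GW (T :: real) \<mu>.
        smooth_cubic G \<and> gromov_witten_axioms G GW \<and>
        T > 0 \<and> c1_eigenvalues G GW = {0, of_real T, - of_real T} \<and>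
        (\<forall>u \<in> c1_eigenvalues G GW - {0}. c1_multiplicity G GW u = 1) \<and>
        attached_eigenvalues G GW 2 \<mu>
        \<longrightarrow>
        (\<Sum>u \<in> c1_eigenvalues G GW - {0}. u) = 0 \<and>
        \<mu> Kuznetsov = (\<Sum>i<2. \<mu> (Line_Bundle i)) / 2 \<and>
        (\<forall>\<theta>. Im (of_real T * exp (- \<i> * of_real \<theta>)) \<noteq> 0 \<longrightarrow>
           (\<forall>i<2. phase_slope \<theta> (\<mu> (Line_Bundle i)) \<noteq> 0) \<and>
           inj_on (\<lambda>i. phase_slope \<theta> (\<mu> (Line_Bundle i))) {..<2} \<and>
           (\<Sum>i<2. phase_slope \<theta> (\<mu> (Line_Bundle i))) = 0 \<and>
           (\<exists>i<2. phase_slope \<theta> (\<mu> (Line_Bundle i)) > 0) \<and>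
           (\<exists>i<2. phase_slope \<theta> (\<mu> (Line_Bundle i)) < 0) \<and>
           phase_slope \<theta> (\<mu> Kuznetsov) = 0 \<and>
           (\<exists>i<2. \<exists>j<2.
              phase_slope \<theta> (\<mu> (Line_Bundle i)) < phase_slope \<theta> (\<mu> Kuznetsov) \<and>
              phase_slope \<theta> (\<mu> Kuznetsov) < phase_slope \<theta> (\<mu> (Line_Bundle j))) \<and>
           (\<forall>ss. induced_ordering 2 \<mu> \<theta> ss \<longrightarrow>
              hd ss \<noteq> Kuznetsov \<and> last ss \<noteq> Kuznetsov \<and>
              length ss = 3 \<and> ss ! 1 = Kuznetsov)))"
proof -
  \<comment> \<open>The Cartesian form of the conjugate root, which is also the square of
    \<open>\<zeta>\<close>. With both folded to \<open>\<omega>\<close>, the eigenvalues in the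
    hypothesis and the sum in the conclusion are written in the same three numbers.\<close>
  define \<omega> where "\<omega> = Complex (- 1 / 2) (- sqrt 3 / 2)"
  have \<zeta>: "\<zeta> = Complex (- 1 / 2) (sqrt 3 / 2)"
    unfolding \<zeta>_def by (rule exp_third_root)
  have sq: "\<zeta>\<^sup>2 = \<omega>"
    by (simp add: \<zeta> \<omega>_def complex_eq_iff power2_eq_square)
  have sum_roots: "1 + \<zeta> + \<omega> = 0"
    by (simp add: \<zeta> \<omega>_def complex_eq_iff)
  show ?thesis
    unfolding exp_minus_third_root \<zeta>_def[symmetric] \<omega>_def[symmetric] sq
  \<comment> \<open>The instantiated \<open>conjI\<close> separates fourfolds from threefolds but
    keeps each conclusion whole.\<close>
  proof (intro conjI[of "All _" "All _"] allI impI, goal_cases)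
    case (1 F GW \<mu>)
    then have ev: "c1_eigenvalues F GW = {0, 9, 9 * \<zeta>, 9 * \<omega>}"
      and att: "attached_eigenvalues F GW 3 \<mu>" by blast+
    note K = attached_eigenvalues_Kuznetsov[OF att]
    have "c1_eigenvalues F GW - {0} = {9, 9 * \<zeta>, 9 * \<omega>}"
      by (auto simp: ev \<zeta> \<omega>_def complex_eq_iff)
    \<comment> \<open>A sum over a set counts each eigenvalue once, so this uses that the three are
      distinct.\<close>
    then have sum: "(\<Sum>u \<in> c1_eigenvalues F GW - {0}. u) = 9 * (1 + \<zeta> + \<omega>)"
      by (simp add: \<zeta> \<omega>_def complex_eq_iff)
    then have sum0: "(\<Sum>u \<in> c1_eigenvalues F GW - {0}. u) = 0"
      by (simp add: sum_roots)
    \<comment> \<open>This holds on every ray: the product of \<open>9 * \<zeta>\<close> and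
      \<open>cnj 9\<close> has imaginary part \<open>81 * sqrt 3 / 2\<close>, so 9 and
      \<open>9 * \<zeta>\<close> do not both have slope 0.\<close>
    have "\<exists>u \<in> c1_eigenvalues F GW. phase_slope \<theta> u \<noteq> 0" for \<theta>
    proof (rule ccontr)
      assume "\<not> ?thesis"
      then have "Im (9 * \<zeta> * cnj 9) = 0"
        by (intro Im_mult_cnj_eq_0_if_phase_slopes_0) (auto simp: ev)
      then show False by (simp add: \<zeta>)
    qed
    then have slopes: "(\<Sum>i<3. phase_slope \<theta> (\<mu> (Line_Bundle i))) = 0"
      "\<exists>i<3. phase_slope \<theta> (\<mu> (Line_Bundle i)) > 0"
      "\<exists>i<3. phase_slope \<theta> (\<mu> (Line_Bundle i)) < 0" for \<theta>
      using slopes_of_both_signs[OF att sum0] by blast+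
    \<comment> \<open>The two sets in \<open>degenerate_rays\<close> are exactly the failures of
      injectivity and of nonvanishing.\<close>
    have nonzero: "\<forall>i<3. phase_slope \<theta> (\<mu> (Line_Bundle i)) \<noteq> 0"
      and inj: "inj_on (\<lambda>i. phase_slope \<theta> (\<mu> (Line_Bundle i))) {..<3}"
      if "\<theta> \<notin> degenerate_rays 3 (\<lambda>i. \<mu> (Line_Bundle i))" for \<theta>
      using that unfolding degenerate_rays_def inj_on_def phase_slope_eq_iff phase_slope_eq_0_iff
      by blast+
    have centroid: "\<mu> Kuznetsov = (\<Sum>i<3. \<mu> (Line_Bundle i)) / 3"
      using K by (simp add: attached_eigenvalues_sum[OF att] sum0)
    \<comment> \<open>Since \<open>slopes\<close> holds for all \<open>\<theta>\<close>, the claim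
      on orderings includes the degenerate rays and every way of breaking ties there.\<close>
    show ?case
      using sum sum_roots centroid nonzero inj slopes K
        Kuznetsov_interior_if_both_signs[OF _ K slopes(2,3)]
      by (simp; blast)
  next
    case (2 G GW T \<mu>)
    then have ev: "c1_eigenvalues G GW = {0, of_real T, - of_real T}" and T: "T > 0"
      and att: "attached_eigenvalues G GW 2 \<mu>" by blast+
    note K = attached_eigenvalues_Kuznetsov[OF att]
    have ev': "c1_eigenvalues G GW - {0} = {of_real T, - of_real T}"
      using T by (auto simp: ev)
    \<comment> \<open>\<open>T > 0\<close> makes the two eigenvalues distinct, so both enter the sum
      and cancel.\<close>
    have sum0: "(\<Sum>u \<in> c1_eigenvalues G GW - {0}. u) = 0"
      using T by (simp add: ev' complex_eq_iff)
    have centroid: "\<mu> Kuznetsov = (\<Sum>i<2. \<mu> (Line_Bundle i)) / 2"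
      using K by (simp add: attached_eigenvalues_sum[OF att] sum0)
    \<comment> \<open>Unlike the fourfold eigenvalues, \<open>T\<close> and \<open>- T\<close> lie
      on one real line: on an excluded ray all three sectors have slope 0 and every order of them is
      induced. Hence the restriction on \<open>\<theta>\<close>.\<close>
    have slopes: "\<forall>i<2. phase_slope \<theta> (\<mu> (Line_Bundle i)) \<noteq> 0"
      "inj_on (\<lambda>i. phase_slope \<theta> (\<mu> (Line_Bundle i))) {..<2}"
      "(\<Sum>i<2. phase_slope \<theta> (\<mu> (Line_Bundle i))) = 0"
      "\<exists>i<2. phase_slope \<theta> (\<mu> (Line_Bundle i)) > 0"
      "\<exists>i<2. phase_slope \<theta> (\<mu> (Line_Bundle i)) < 0"
      if "Im (of_real T * exp (- \<i> * of_real \<theta>)) \<noteq> 0" for \<theta>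
    proof -
      have T_slope: "phase_slope \<theta> (of_real T) \<noteq> 0"
        using that by (simp only: phase_slope_eq_0_iff not_False_eq_True)
      have "of_real T \<in> c1_eigenvalues G GW" by (simp add: ev)
      note both_signs = slopes_of_both_signs[OF att sum0 this T_slope]
      show "(\<Sum>i<2. phase_slope \<theta> (\<mu> (Line_Bundle i))) = 0"
        "\<exists>i<2. phase_slope \<theta> (\<mu> (Line_Bundle i)) > 0"
        "\<exists>i<2. phase_slope \<theta> (\<mu> (Line_Bundle i)) < 0"
        by (fact both_signs)+
      show nonzero: "\<forall>i<2. phase_slope \<theta> (\<mu> (Line_Bundle i)) \<noteq> 0"
      proof (intro allI impI)
        fix i :: nat
        assume "i < 2"
        then have "\<mu> (Line_Bundle i) \<in> {of_real T, - of_real T}"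
          using attached_eigenvalues_image[OF att] ev' by blast
        then show "phase_slope \<theta> (\<mu> (Line_Bundle i)) \<noteq> 0"
          using T_slope by (auto simp: phase_slope_minus)
      qed
      \<comment> \<open>The two slopes sum to 0, so if they were equal both would vanish.\<close>
      show "inj_on (\<lambda>i. phase_slope \<theta> (\<mu> (Line_Bundle i))) {..<2}"
        using both_signs(1) nonzero
        by (auto simp: numeral_2_eq_2 lessThan_Suc)
    qed
    have interior: "hd ss \<noteq> Kuznetsov \<and> last ss \<noteq> Kuznetsov \<and> length ss = 3 \<and> ss ! 1 = Kuznetsov"
      if ray: "Im (of_real T * exp (- \<i> * of_real \<theta>)) \<noteq> 0" and ord: "induced_ordering 2 \<mu> \<theta> ss"
      for \<theta> ss
    proof -
      have len: "length ss = 3" using length_induced_ordering[OF ord] by simp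
      \<comment> \<open>Among three positions only index 1 is interior.\<close>
      have "k = 1" if "0 < k" "k < length ss - 1" for k using that len by simp
      then show ?thesis
        using Kuznetsov_interior_if_both_signs[OF ord K slopes(4,5)[OF ray]] len by blast
    qed
    show ?case
      using sum0 centroid slopes K interior by (simp; blast)
  qed
qed

end
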